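(* Let $k$ be a prime field, $k<K$ a field extension, and $W$ a $k$-subspace of $K$ such that $k\cap W=0$ and $W$ generates $K$ as a field over $k$. If $\mathrm{char}(k)=2$, suppose also that $K$ is a perfect field. Let $Q=Q_{k<K}(W)$ and let $S(W)=\{A\in\mathrm{GL}_k(K): A^{-1}M_WA=M_W\}$. Then the group $\mathrm{Aut}(Q)$ of automorphisms of the loop $Q$ is isomorphic to the semidirect product $S(W)\ltimes K$, i.e. the group on the set $S(W)\times K$ with multiplication $(A,c)(B,d)=(AB,\;cB+d)$.
   Context: Here $k<K$ means that $K$ is a field and $k$ a proper subfield. For a $k$-subspace $W$ of $K$ with $k\cap W=0$, the loop $Q_{k<K}(W)$ is the set $W\times K$ with multiplication $(a,u)(b,v)=(a+b,\;u(1+b)+v(1-a))$, where all operations on the right are those of $K$ (this is a loop). Maps are written on the right of their arguments and composed left to right. For $a\in K$, $M_a:K\to K$ is the map $bM_a=ba$, and $M_W=\{M_a:a\in W\}$. $\mathrm{GL}_k(K)$ is the group of all invertible $k$-linear maps $K\to K$. *)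

theory Defs
  imports "HOL-Algebra.Bij" "HOL-Algebra.Generated_Fields" "HOL-Algebra.Algebraic_Closure_Type"
begin

text \<open>The field \<open>K\<close> is the type \<open>'a :: field\<close>. Its subfields, subspaces and subsets are sets of
  type \<open>'a set\<close>, referred to the following ring record with carrier \<open>UNIV\<close>.\<close>

abbreviation KK :: "'a :: field ring" where
  "KK \<equiv> ring_of_type_algebra"

definition prime_subfield :: "'a :: field set \<Rightarrow> bool" where
  "prime_subfield k \<longleftrightarrow> subfield k KK \<and> (\<forall>F. subfield F KK \<and> F \<subseteq> k \<longrightarrow> F = k)"

definition perfect_field :: "'a :: field itself \<Rightarrow> bool" where
  "perfect_field _ \<longleftrightarrow> CHAR('a) = 0 \<or> surj (\<lambda>x :: 'a. x ^ CHAR('a))"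

text \<open>Despite its name, the library locale \<open>subalgebra k W R\<close> says that \<open>W\<close> is an additive
  subgroup of \<open>R\<close> closed under multiplication by elements of \<open>k\<close>, i.e. a \<open>k\<close>-subspace.\<close>

abbreviation k_subspace :: "'a :: field set \<Rightarrow> 'a set \<Rightarrow> bool" where
  "k_subspace k W \<equiv> subalgebra k W KK"

text \<open>Maps are written on the right and composed from left to right in the mathematical notation;
  so \<open>x A\<close> is \<open>A x\<close>, and the product \<open>A B\<close> is \<open>B \<circ> A\<close>.\<close>

definition loopQ :: "'a :: field set \<Rightarrow> ('a \<times> 'a) monoid" where
  "loopQ W = \<lparr>carrier = W \<times> UNIV,
     monoid.mult = (\<lambda>(a, u) (b, v). (a + b, u * (1 + b) + v * (1 - a))),
     one = (0, 0)\<rparr>"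

text \<open>The library set \<open>auto Q\<close> consists of the bijections of \<open>carrier Q\<close> that preserve the
  multiplication (and are \<open>undefined\<close> outside the carrier). The library's \<open>AutoGroup\<close> composes
  from right to left, hence is the opposite of the following group.\<close>

definition Aut :: "'b monoid \<Rightarrow> ('b \<Rightarrow> 'b) monoid" where
  "Aut Q = \<lparr>carrier = auto Q,
     monoid.mult = (\<lambda>f g. compose (carrier Q) g f),
     one = (\<lambda>x\<in>carrier Q. x)\<rparr>"

definition mult_map :: "'a :: field \<Rightarrow> 'a \<Rightarrow> 'a" where
  "mult_map a = (\<lambda>b. b * a)"

definition GL_over :: "'a :: field set \<Rightarrow> ('a \<Rightarrow> 'a) set" where
  "GL_over k = {A. bij A \<and> (\<forall>x y. A (x + y) = A x + A y) \<and> (\<forall>c\<in>k. \<forall>x. A (c * x) = c * A x)}"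

definition S_stab :: "'a :: field set \<Rightarrow> 'a set \<Rightarrow> ('a \<Rightarrow> 'a) set" where
  "S_stab k W = {A \<in> GL_over k. (\<lambda>T. A \<circ> T \<circ> inv_into UNIV A) ` (mult_map ` W) = mult_map ` W}"

definition semidirect :: "('a :: field \<Rightarrow> 'a) set \<Rightarrow> (('a \<Rightarrow> 'a) \<times> 'a) monoid" where
  "semidirect H = \<lparr>carrier = H \<times> UNIV,
     monoid.mult = (\<lambda>(A, c) (B, d). (B \<circ> A, B c + d)),
     one = (id, 0)\<rparr>"

end

theory Submission
  imports Defs
begin

text \<open>
  Everything rests on the associator of the loop: \<open>(a,u)\<close>, \<open>(b,v)\<close>, \<open>(c,w)\<close> associate in this
  order exactly when \<open>b (u c - w a) = 0\<close> (\<open>loopQ_assoc_iff\<close>). Hence the middle nucleus of \<open>Q\<close> is the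
  fibre \<open>{0} \<times> K\<close>, in every characteristic, and every automorphism \<open>f\<close> preserves it. On this fibre
  \<open>f\<close> is an additive bijection \<open>A\<close> of \<open>K\<close>, and on the quotient \<open>W\<close> it is a map \<open>\<phi>\<close> onto \<open>W\<close>;
  write \<open>f (a, 0) = (\<phi> a, g a)\<close>. Since \<open>(a, 0) (0, u) = (a, u (1 - a))\<close>, these three maps
  determine \<open>f\<close>.

  The main point is that \<open>A\<close> carries multiplication by \<open>a\<close> to multiplication by \<open>\<phi> a\<close>, that is,
  \<open>A (u a) = A u \<cdot> \<phi> a\<close> for \<open>a \<in> W\<close>. An element \<open>(a, s (1 - a) (1 + a))\<close> is both a left and a
  right multiple of \<open>(a, 0)\<close> by fibre elements. Comparing the two images gives twice the desired
  identity, which settles characteristic other than \<open>2\<close> (\<open>intertwines_A_\<phi>_odd\<close>). In characteristic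
  \<open>2\<close> the loop is commutative and this comparison is empty. What remains is the inner mapping on
  the fibre that comes from multiplying twice by \<open>(a, 0)\<close>; it only shows that \<open>A\<close> carries
  multiplication by \<open>a\<^sup>2\<close> to multiplication by \<open>(\<phi> a)\<^sup>2\<close>. The \<open>x\<close> such that multiplication by
  \<open>x\<^sup>2\<close> is carried to some multiplication form a subfield containing \<open>W\<close>, hence all of \<open>K\<close>. As \<open>K\<close> is
  perfect, \<open>a\<close> is a square, so multiplication by \<open>a\<close> is carried to multiplication by some \<open>y\<close>, and
  injectivity of squaring gives \<open>y = \<phi> a\<close> (\<open>intertwines_A_\<phi>_even\<close>).

  Finally \<open>(a, 0)\<close>, \<open>(e, 0)\<close>, \<open>(e, 0)\<close> associate, so their images do; by the associator formula
  \<open>g\<close> is a constant multiple \<open>c \<phi>\<close> of \<open>\<phi>\<close> (\<open>g_proportional\<close>). Thus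
  \<open>f (a, u) = (\<phi> a, A u + c \<cdot> \<phi> a)\<close> with \<open>A \<in> S(W)\<close>, where \<open>A\<close> is \<open>k\<close>-linear because \<open>k\<close> is prime.
  Conversely all these maps are automorphisms, and they compose by the rule of the semidirect
  product (\<open>aut_of_mem_auto\<close>, \<open>aut_of_comp\<close>).
\<close>

section \<open>Subfields of the ambient field\<close>

lemma KK_simps [simp]:
  "carrier (KK :: 'a::field ring) = UNIV" "x \<otimes>\<^bsub>KK\<^esub> y = x * y" "x \<oplus>\<^bsub>KK\<^esub> y = x + y"
  "\<one>\<^bsub>KK\<^esub> = (1::'a)" "\<zero>\<^bsub>KK\<^esub> = (0::'a)"
  by (simp_all add: ring_of_type_algebra_def)

lemma KK_a_inv [simp]: "\<ominus>\<^bsub>KK\<^esub> x = - (x :: 'a::field)"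
  by (rule abelian_group.minus_equality[OF ring.is_abelian_group[OF ring_from_type_algebra]]) simp_all

lemma KK_m_inv: "(x :: 'a::field) \<noteq> 0 \<Longrightarrow> inv\<^bsub>KK\<^esub> x = inverse x"
  by (rule comm_monoid.comm_inv_char[OF cring.axioms(2)[OF cring_from_type_algebra]]) simp_all

lemma subfield_KK_I:
  fixes F :: "'a::field set"
  assumes "1 \<in> F" and "\<And>x. x \<in> F \<Longrightarrow> - x \<in> F"
    and "\<And>x y. x \<in> F \<Longrightarrow> y \<in> F \<Longrightarrow> x + y \<in> F"
    and "\<And>x y. x \<in> F \<Longrightarrow> y \<in> F \<Longrightarrow> x * y \<in> F"
    and "\<And>x. x \<in> F \<Longrightarrow> x \<noteq> 0 \<Longrightarrow> inverse x \<in> F"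
  shows "subfield F KK"
proof (rule field.subfieldI'[OF field_from_type_algebra])
  show "subring F KK"
    by (rule ring.subringI[OF ring_from_type_algebra]) (use assms in auto)
  show "inv\<^bsub>KK\<^esub> x \<in> F" if "x \<in> F - {\<zero>\<^bsub>KK\<^esub>}" for x
    using that assms(5) by (auto simp: KK_m_inv)
qed

lemma prime_subfield_subset:
  fixes k F :: "'a::field set"
  assumes k: "prime_subfield k" and F: "subfield F KK"
  shows "k \<subseteq> F"
proof -
  have k': "subfield k KK" using k by (simp add: prime_subfield_def)
  note sub = ring.subfield_m_inv(1)[OF ring_from_type_algebra]
  have "subfield (k \<inter> F) KK"
  proof (rule field.subfieldI'[OF field_from_type_algebra])
    show "subring (k \<inter> F) KK"
      using ring.subring_inter[OF ring_from_type_algebra] subfieldE(1) k' F by blast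
    show "inv\<^bsub>KK\<^esub> x \<in> k \<inter> F" if "x \<in> k \<inter> F - {\<zero>\<^bsub>KK\<^esub>}" for x
      using sub[OF k'] sub[OF F] that by blast
  qed
  then have "k \<inter> F = k" using k unfolding prime_subfield_def by blast
  then show ?thesis by blast
qed

section \<open>Additive maps that intertwine multiplications\<close>

definition intertwines :: "('a::field \<Rightarrow> 'a) \<Rightarrow> 'a \<Rightarrow> 'a \<Rightarrow> bool" where
  "intertwines A x y \<longleftrightarrow> (\<forall>u. A (u * x) = A u * y)"

lemma intertwinesD: "intertwines A x y \<Longrightarrow> A (u * x) = A u * y"
  by (simp add: intertwines_def)

lemma intertwines_one: "intertwines A 1 1"
  by (simp add: intertwines_def)

lemma intertwines_mult:
  "intertwines A x y \<Longrightarrow> intertwines A x' y' \<Longrightarrow> intertwines A (x * x') (y * y')"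
  by (simp add: intertwines_def mult.assoc[symmetric])

lemma intertwines_comp:
  "intertwines A x y \<Longrightarrow> intertwines B y z \<Longrightarrow> intertwines (B \<circ> A) x z"
  by (simp add: intertwines_def)

text \<open>If \<open>A\<close> carries multiplication by \<open>x\<close> to multiplication by \<open>y\<close>, then evaluating at the
  preimage of \<open>1\<close> recovers \<open>y\<close>. So \<open>twist A x\<close> is the only possible partner of \<open>x\<close>, given by a formula
  that makes sense for all \<open>x\<close>.\<close>

definition twist :: "('a::field \<Rightarrow> 'a) \<Rightarrow> 'a \<Rightarrow> 'a" where
  "twist A x = A (inv_into UNIV A 1 * x)"

lemma intertwines_twist: "bij A \<Longrightarrow> intertwines A x y \<Longrightarrow> y = twist A x"
  by (simp add: twist_def intertwines_def bij_is_surj surj_f_inv_f)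

locale additive_bijection =
  fixes A :: "'a::field \<Rightarrow> 'a"
  assumes bij: "bij A" and add: "A (x + y) = A x + A y"
begin

lemma zero [simp]: "A 0 = 0"
  using add[of 0 0] by (metis add.right_neutral add_left_cancel)

lemma minus: "A (- x) = - A x"
  using add[of x "- x"] by (simp add: eq_neg_iff_add_eq_0 add.commute)

lemma diff: "A (x - y) = A x - A y"
  using add[of x "- y"] by (simp add: minus)

lemma eq_iff: "A x = A y \<longleftrightarrow> x = y"
  using bij by (simp add: bij_is_inj inj_eq)

lemma eq_zero_iff: "A x = 0 \<longleftrightarrow> x = 0"
  using eq_iff[of x 0] by simp

lemma intertwines_add:
  "intertwines A x y \<Longrightarrow> intertwines A x' y' \<Longrightarrow> intertwines A (x + x') (y + y')"
  by (simp add: intertwines_def distrib_left add)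

lemma intertwines_minus: "intertwines A x y \<Longrightarrow> intertwines A (- x) (- y)"
  by (simp add: intertwines_def minus)

lemma intertwines_inverse:
  assumes xy: "intertwines A x y" and x: "x \<noteq> 0"
  shows "intertwines A (inverse x) (inverse y)"
proof -
  have y: "y \<noteq> 0"
    using intertwinesD[OF xy, of 1] x eq_zero_iff[of x] by auto
  have "A (u * inverse x) = A u * inverse y" for u
    using intertwinesD[OF xy, of "u * inverse x"] x y by (simp add: field_simps)
  then show ?thesis by (simp add: intertwines_def)
qed

text \<open>The scalars over which \<open>A\<close> is linear form a subfield, which has to contain the prime field.\<close>

lemma mem_GL_over_prime:
  assumes "prime_subfield k"
  shows "A \<in> GL_over k"
proof -
  have "subfield {x. intertwines A x x} KK"
    by (rule subfield_KK_I)
      (auto intro: intertwines_one intertwines_minus intertwines_add intertwines_mult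
        intertwines_inverse)
  then have "k \<subseteq> {x. intertwines A x x}" by (rule prime_subfield_subset[OF assms])
  then have "A (c * x) = c * A x" if "c \<in> k" for c x
    using that by (auto simp: intertwines_def mult.commute)
  then show ?thesis by (simp add: GL_over_def bij add)
qed

lemma inj_twist: "inj (twist A)"
proof (rule injI)
  fix x y assume "twist A x = twist A y"
  moreover have "inv_into UNIV A 1 \<noteq> 0"
    using surj_f_inv_f[OF bij_is_surj[OF bij], of 1] zero by (metis zero_neq_one)
  ultimately show "x = y" by (simp add: twist_def eq_iff)
qed

end

lemma GL_over_additive_bijection: "A \<in> GL_over k \<Longrightarrow> additive_bijection A"
  by (simp add: GL_over_def additive_bijection_def)

text \<open>With maps written on the right, the left-hand side is \<open>A\<^sup>-\<^sup>1 M\<^sub>x A\<close>: membership in the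
  stabilizer becomes a statement about intertwined multiplications.\<close>

lemma conj_mult_map_eq_iff:
  assumes "bij A"
  shows "A \<circ> mult_map x \<circ> inv_into UNIV A = mult_map y \<longleftrightarrow> intertwines A x y"
proof
  assume eq: "A \<circ> mult_map x \<circ> inv_into UNIV A = mult_map y"
  have "A (u * x) = A u * y" for u
    using fun_cong[OF eq, of "A u"] assms by (simp add: mult_map_def bij_is_inj)
  then show "intertwines A x y" by (simp add: intertwines_def)
next
  assume "intertwines A x y"
  then show "A \<circ> mult_map x \<circ> inv_into UNIV A = mult_map y"
    using assms by (simp add: fun_eq_iff mult_map_def intertwines_def bij_is_surj surj_f_inv_f)
qed

lemma inj_mult_map: "inj (mult_map :: 'a::field \<Rightarrow> _)"
  by (rule injI) (metis mult_map_def mult_1)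

lemma mem_S_stab_iff:
  "A \<in> S_stab k W \<longleftrightarrow>
    A \<in> GL_over k \<and> twist A ` W = W \<and> (\<forall>a\<in>W. intertwines A a (twist A a))"
proof (cases "A \<in> GL_over k")
  case True
  then have bij: "bij A" by (simp add: GL_over_def)
  let ?C = "\<lambda>T. A \<circ> T \<circ> inv_into UNIV A"
  have *: "?C (mult_map a) = mult_map y \<longleftrightarrow> intertwines A a y" for a y
    by (rule conj_mult_map_eq_iff[OF bij])
  have "?C ` (mult_map ` W) = mult_map ` W \<longleftrightarrow>
      twist A ` W = W \<and> (\<forall>a\<in>W. intertwines A a (twist A a))" (is "?L \<longleftrightarrow> ?R")
  proof
    assume L: ?L
    have int: "intertwines A a (twist A a)" if "a \<in> W" for a
    proof -
      have "?C (mult_map a) \<in> mult_map ` W" using L that by blast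
      then obtain y where "?C (mult_map a) = mult_map y" by blast
      then show ?thesis using * intertwines_twist[OF bij] by metis
    qed
    then have "?C ` mult_map ` W = mult_map ` twist A ` W"
      unfolding image_image using * by (intro image_cong) auto
    then have "mult_map ` twist A ` W = mult_map ` W" using L by simp
    then show ?R using int inj_image_eq_iff[OF inj_mult_map] by metis
  next
    assume R: ?R
    then have "?C ` mult_map ` W = mult_map ` twist A ` W"
      unfolding image_image using * by (intro image_cong) auto
    then show ?L using R by simp
  qed
  then show ?thesis using True by (simp add: S_stab_def)
qed (simp add: S_stab_def)

lemma twist_comp:
  assumes "A \<in> S_stab k W" "B \<in> S_stab k W" "a \<in> W"
  shows "intertwines (B \<circ> A) a (twist B (twist A a))" "twist (B \<circ> A) a = twist B (twist A a)"
proof -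
  have A: "bij A" "intertwines A a (twist A a)" "twist A a \<in> W"
    using assms(1,3) by (auto simp: mem_S_stab_iff GL_over_def)
  have B: "bij B" "intertwines B (twist A a) (twist B (twist A a))"
    using assms(2) A(3) by (auto simp: mem_S_stab_iff GL_over_def)
  show int: "intertwines (B \<circ> A) a (twist B (twist A a))"
    using intertwines_comp[OF A(2) B(2)] .
  show "twist (B \<circ> A) a = twist B (twist A a)"
    using intertwines_twist[OF bij_comp[OF A(1) B(1)] int] by simp
qed

lemma S_stab_comp:
  assumes "A \<in> S_stab k W" "B \<in> S_stab k W"
  shows "B \<circ> A \<in> S_stab k W"
proof -
  have "B \<circ> A \<in> GL_over k"
    using assms by (auto simp: mem_S_stab_iff GL_over_def intro: bij_comp)
  moreover have "twist (B \<circ> A) ` W = twist B ` twist A ` W"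
    unfolding image_image by (rule image_cong) (simp_all add: twist_comp(2)[OF assms])
  moreover have "\<dots> = W" using assms by (simp add: mem_S_stab_iff)
  ultimately show ?thesis
    using twist_comp[OF assms] by (simp add: mem_S_stab_iff)
qed

section \<open>The loop and its middle nucleus\<close>

lemma loopQ_simps [simp]:
  "carrier (loopQ W) = W \<times> UNIV"
  "(a, u) \<otimes>\<^bsub>loopQ W\<^esub> (b, v) = (a + b, u * (1 + b) + v * (1 - a))"
  by (simp_all add: loopQ_def)

text \<open>The two sides differ by \<open>b (u c - w a)\<close> in the second coordinate.\<close>

lemma loopQ_assoc_iff:
  "((a, u) \<otimes>\<^bsub>loopQ W\<^esub> (b, v)) \<otimes>\<^bsub>loopQ W\<^esub> (c, w) = (a, u) \<otimes>\<^bsub>loopQ W\<^esub> ((b, v) \<otimes>\<^bsub>loopQ W\<^esub> (c, w))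
    \<longleftrightarrow> b = 0 \<or> u * c = w * (a :: 'a::field)"
proof -
  have "((u * (1 + b) + v * (1 - a)) * (1 + c) + w * (1 - (a + b)))
      - (u * (1 + (b + c)) + (v * (1 + c) + w * (1 - b)) * (1 - a)) = b * (u * c - w * a)"
    by (simp add: algebra_simps)
  then have "(u * (1 + b) + v * (1 - a)) * (1 + c) + w * (1 - (a + b))
      = u * (1 + (b + c)) + (v * (1 + c) + w * (1 - b)) * (1 - a) \<longleftrightarrow> b * (u * c - w * a) = 0"
    by (metis eq_iff_diff_eq_0)
  then show ?thesis by (simp add: add.assoc)
qed

definition middle_nucleus :: "'b monoid \<Rightarrow> 'b set" where
  "middle_nucleus Q = {y \<in> carrier Q. \<forall>x\<in>carrier Q. \<forall>z\<in>carrier Q.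
     (x \<otimes>\<^bsub>Q\<^esub> y) \<otimes>\<^bsub>Q\<^esub> z = x \<otimes>\<^bsub>Q\<^esub> (y \<otimes>\<^bsub>Q\<^esub> z)}"

lemma autoD:
  assumes "f \<in> auto Q"
  shows "x \<in> carrier Q \<Longrightarrow> y \<in> carrier Q \<Longrightarrow> f (x \<otimes>\<^bsub>Q\<^esub> y) = f x \<otimes>\<^bsub>Q\<^esub> f y"
    and "bij_betw f (carrier Q) (carrier Q)" and "f \<in> extensional (carrier Q)"
  using assms by (simp_all add: auto_def hom_def Bij_def)

lemma auto_middle_nucleus_iff:
  assumes f: "f \<in> auto Q" and y: "y \<in> carrier Q"
    and closed: "\<And>x z. x \<in> carrier Q \<Longrightarrow> z \<in> carrier Q \<Longrightarrow> x \<otimes>\<^bsub>Q\<^esub> z \<in> carrier Q"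
  shows "f y \<in> middle_nucleus Q \<longleftrightarrow> y \<in> middle_nucleus Q"
proof -
  note f' = autoD[OF f]
  have mem: "f x \<in> carrier Q" if "x \<in> carrier Q" for x
    using f'(2) that by (meson bij_betwE)
  have inj: "f x = f z \<longleftrightarrow> x = z" if "x \<in> carrier Q" "z \<in> carrier Q" for x z
    using f'(2) that by (meson bij_betw_def inj_on_eq_iff)
  have "(f x \<otimes>\<^bsub>Q\<^esub> f y) \<otimes>\<^bsub>Q\<^esub> f z = f x \<otimes>\<^bsub>Q\<^esub> (f y \<otimes>\<^bsub>Q\<^esub> f z) \<longleftrightarrow>
      (x \<otimes>\<^bsub>Q\<^esub> y) \<otimes>\<^bsub>Q\<^esub> z = x \<otimes>\<^bsub>Q\<^esub> (y \<otimes>\<^bsub>Q\<^esub> z)" if "x \<in> carrier Q" "z \<in> carrier Q" for x z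
    using that y by (simp add: f'(1)[symmetric] closed inj)
  moreover have "f y \<in> middle_nucleus Q \<longleftrightarrow> (\<forall>x\<in>f ` carrier Q. \<forall>z\<in>f ` carrier Q.
      (x \<otimes>\<^bsub>Q\<^esub> f y) \<otimes>\<^bsub>Q\<^esub> z = x \<otimes>\<^bsub>Q\<^esub> (f y \<otimes>\<^bsub>Q\<^esub> z))"
    using mem[OF y] by (simp add: middle_nucleus_def bij_betw_imp_surj_on[OF f'(2)])
  ultimately show ?thesis using y by (simp add: middle_nucleus_def)
qed

text \<open>Since \<open>1 \<notin> W\<close>, the factor \<open>1 - a\<close> never vanishes, so left multiplication by \<open>(a, 0)\<close> maps
  \<open>{0} \<times> K\<close> onto \<open>{a} \<times> K\<close>. A nonzero element of \<open>W\<close> serves to detect the middle nucleus and to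
  read off the translation part of an automorphism.\<close>

locale loopQ_space =
  fixes W :: "'a::field set"
  assumes zero_mem [simp]: "0 \<in> W"
    and add_mem [intro]: "a \<in> W \<Longrightarrow> b \<in> W \<Longrightarrow> a + b \<in> W"
    and minus_mem [intro]: "a \<in> W \<Longrightarrow> - a \<in> W"
    and one_not_mem: "1 \<notin> W"
    and nontrivial: "W \<noteq> {0}"
begin

lemma factor_nonzero: "a \<in> W \<Longrightarrow> 1 - a \<noteq> 0"
  using one_not_mem by auto

lemma obtain_nonzero: obtains e where "e \<in> W" "e \<noteq> 0"
  using nontrivial zero_mem by blast

lemma loopQ_closed: "x \<in> W \<times> UNIV \<Longrightarrow> y \<in> W \<times> UNIV \<Longrightarrow> x \<otimes>\<^bsub>loopQ W\<^esub> y \<in> W \<times> UNIV"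
  by (cases x; cases y) auto

text \<open>For \<open>b \<noteq> 0\<close> the triple \<open>(0,1)\<close>, \<open>(b,v)\<close>, \<open>(e,0)\<close> with \<open>0 \<noteq> e \<in> W\<close> has associator \<open>b e \<noteq> 0\<close>.\<close>

lemma middle_nucleus_loopQ: "middle_nucleus (loopQ W) = {0} \<times> UNIV"
proof -
  have "b = 0" if "(b, v) \<in> middle_nucleus (loopQ W)" for b v
  proof -
    obtain e where e: "e \<in> W" "e \<noteq> 0" by (rule obtain_nonzero)
    have "((0, 1) \<otimes>\<^bsub>loopQ W\<^esub> y) \<otimes>\<^bsub>loopQ W\<^esub> (e, 0)
        = (0, 1) \<otimes>\<^bsub>loopQ W\<^esub> (y \<otimes>\<^bsub>loopQ W\<^esub> (e, 0))"
      if "y \<in> middle_nucleus (loopQ W)" for y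
      using that e(1) by (simp add: middle_nucleus_def del: loopQ_simps(2))
    from this[OF that]
    show "b = 0" using e unfolding loopQ_assoc_iff by simp
  qed
  moreover have "(0, v) \<in> middle_nucleus (loopQ W)" for v
    by (auto simp: middle_nucleus_def loopQ_assoc_iff simp del: loopQ_simps(2))
  ultimately show ?thesis by auto
qed

section \<open>The automorphisms given by the semidirect product\<close>

definition aut_of :: "('a \<Rightarrow> 'a) \<Rightarrow> 'a \<Rightarrow> 'a \<times> 'a \<Rightarrow> 'a \<times> 'a" where
  "aut_of A c = (\<lambda>(a, u)\<in>W \<times> UNIV. (twist A a, A u + c * twist A a))"

lemma aut_of_apply [simp]: "a \<in> W \<Longrightarrow> aut_of A c (a, u) = (twist A a, A u + c * twist A a)"
  by (simp add: aut_of_def)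

lemma aut_of_mem_auto:
  assumes A: "A \<in> S_stab k W"
  shows "aut_of A c \<in> auto (loopQ W)"
proof -
  interpret additive_bijection A
    using A by (intro GL_over_additive_bijection[of _ k]) (simp add: mem_S_stab_iff)
  have tw: "twist A ` W = W" and int: "\<And>a u. a \<in> W \<Longrightarrow> A (u * a) = A u * twist A a"
    using A by (auto simp: mem_S_stab_iff intertwines_def)
  have tw_mem: "twist A a \<in> W" if "a \<in> W" for a using tw that by blast
  have tw_add: "twist A (a + b) = twist A a + twist A b" for a b
    by (simp add: twist_def distrib_left add)
  have "aut_of A c \<in> hom (loopQ W) (loopQ W)"
  proof (rule homI)
    fix x y assume "x \<in> carrier (loopQ W)" "y \<in> carrier (loopQ W)"
    then obtain a u b v where "x = (a, u)" "y = (b, v)" "a \<in> W" "b \<in> W" by auto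
    then show "aut_of A c (x \<otimes>\<^bsub>loopQ W\<^esub> y) = aut_of A c x \<otimes>\<^bsub>loopQ W\<^esub> aut_of A c y"
      by (simp add: add_mem tw_add add diff int ring_distribs right_diff_distrib)
  qed (auto simp: tw_mem)
  moreover have "bij_betw (aut_of A c) (W \<times> UNIV) (W \<times> UNIV)"
  proof (rule bij_betw_imageI)
    show "inj_on (aut_of A c) (W \<times> UNIV)"
      by (auto simp: inj_on_def eq_iff inj_eq[OF inj_twist])
    have "(b, v) \<in> aut_of A c ` (W \<times> UNIV)" if "b \<in> W" for b v
    proof -
      obtain a where a: "a \<in> W" "b = twist A a" using tw \<open>b \<in> W\<close> by blast
      obtain u where "A u = v - c * b" using bij by (metis bij_pointE)
      then have "aut_of A c (a, u) = (b, v)" using a by simp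
      then show ?thesis using a(1) by (metis SigmaI UNIV_I image_eqI)
    qed
    then show "aut_of A c ` (W \<times> UNIV) = W \<times> UNIV" using tw_mem by auto
  qed
  ultimately show ?thesis by (simp add: auto_def Bij_def aut_of_def)
qed

text \<open>The restriction to the fibre over \<open>0\<close> determines \<open>A\<close>; the value at \<open>(e, 0)\<close> for any nonzero
  \<open>e \<in> W\<close> then determines \<open>c\<close>.\<close>

lemma aut_of_inj:
  assumes A: "A \<in> S_stab k W" and B: "B \<in> S_stab k W" and eq: "aut_of A c = aut_of B d"
  shows "A = B" "c = d"
proof -
  interpret A: additive_bijection A
    using A by (intro GL_over_additive_bijection[of _ k]) (simp add: mem_S_stab_iff)
  interpret B: additive_bijection B
    using B by (intro GL_over_additive_bijection[of _ k]) (simp add: mem_S_stab_iff)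
  have "A u = B u" for u
    using fun_cong[OF eq, of "(0, u)"] by (simp add: twist_def)
  then show AB: "A = B" by blast
  obtain e where e: "e \<in> W" "e \<noteq> 0" by (rule obtain_nonzero)
  have "twist A e \<noteq> 0"
    using inj_eq[OF A.inj_twist, of e 0] e by (simp add: twist_def)
  then show "c = d" using fun_cong[OF eq, of "(e, 0)"] e AB by simp
qed

lemma aut_of_comp:
  assumes A: "A \<in> S_stab k W" and B: "B \<in> S_stab k W"
  shows "aut_of (B \<circ> A) (B c + d) = compose (W \<times> UNIV) (aut_of B d) (aut_of A c)"
proof (rule extensionalityI)
  fix x assume "x \<in> W \<times> (UNIV :: 'a set)"
  then obtain a u where x: "x = (a, u)" "a \<in> W" by auto
  have a': "twist A a \<in> W" using A x by (auto simp: mem_S_stab_iff)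
  have "B (c * twist A a) = B c * twist B (twist A a)"
    using B a' by (auto simp: mem_S_stab_iff intertwines_def)
  moreover have "B (y + z) = B y + B z" for y z
    using B by (simp add: mem_S_stab_iff GL_over_def)
  ultimately show "aut_of (B \<circ> A) (B c + d) x = compose (W \<times> UNIV) (aut_of B d) (aut_of A c) x"
    using x a' by (simp add: compose_eq twist_comp(2)[OF A B] distrib_right)
qed (simp_all add: aut_of_def)

end

section \<open>Every automorphism has this form\<close>

locale loopQ_automorphism = loopQ_space +
  fixes f :: "'a \<times> 'a \<Rightarrow> 'a \<times> 'a"
  assumes f: "f \<in> auto (loopQ W)"
begin

definition A where "A u = snd (f (0, u))"
definition \<phi> where "\<phi> a = fst (f (a, 0))"
definition g where "g a = snd (f (a, 0))"

lemma f_mult: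
  "a \<in> W \<Longrightarrow> b \<in> W \<Longrightarrow> f ((a, u) \<otimes>\<^bsub>loopQ W\<^esub> (b, v)) = f (a, u) \<otimes>\<^bsub>loopQ W\<^esub> f (b, v)"
  by (rule autoD(1)[OF f]) auto

lemma f_hom:
  "x \<in> W \<times> UNIV \<Longrightarrow> y \<in> W \<times> UNIV \<Longrightarrow> f (x \<otimes>\<^bsub>loopQ W\<^esub> y) = f x \<otimes>\<^bsub>loopQ W\<^esub> f y"
  by (rule autoD(1)[OF f]) auto

lemma f_bij: "bij_betw f (W \<times> UNIV) (W \<times> UNIV)"
  using autoD(2)[OF f] by simp

text \<open>The fibre over \<open>0\<close> is the middle nucleus, a characteristic subset of the loop.\<close>

lemma fst_f_eq_zero_iff:
  assumes "a \<in> W"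
  shows "fst (f (a, u)) = 0 \<longleftrightarrow> a = 0"
  using auto_middle_nucleus_iff[OF f, of "(a, u)"] assms loopQ_closed
  by (simp add: middle_nucleus_loopQ mem_Times_iff)

lemma f_fibre: "f (0, u) = (0, A u)"
  using fst_f_eq_zero_iff[of 0 u] by (simp add: A_def prod_eq_iff)

lemma f_section: "f (a, 0) = (\<phi> a, g a)"
  by (simp add: \<phi>_def g_def)

lemma \<phi>_mem: "a \<in> W \<Longrightarrow> \<phi> a \<in> W"
  using f_bij unfolding \<phi>_def by (metis SigmaI UNIV_I bij_betwE mem_Sigma_iff prod.collapse)

lemma f_left: "a \<in> W \<Longrightarrow> f (a, u * (1 - a)) = (\<phi> a, g a + A u * (1 - \<phi> a))"
  using f_mult[of a 0 0 u] by (simp add: f_fibre f_section)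

lemma f_right: "a \<in> W \<Longrightarrow> f (a, u * (1 + a)) = (\<phi> a, A u * (1 + \<phi> a) + g a)"
  using f_mult[of 0 a u 0] by (simp add: f_fibre f_section)

lemma fst_f: "a \<in> W \<Longrightarrow> fst (f (a, u)) = \<phi> a"
  using f_left[of a "u / (1 - a)"] factor_nonzero[of a] by simp

lemma \<phi>_image: "\<phi> ` W = W"
proof
  show "W \<subseteq> \<phi> ` W"
  proof
    fix b assume "b \<in> W"
    then have "(b, 0) \<in> f ` (W \<times> UNIV)" using f_bij by (simp add: bij_betw_def)
    then obtain a u where "a \<in> W" "f (a, u) = (b, 0)" by (auto simp: image_iff)
    then show "b \<in> \<phi> ` W" using fst_f[of a u] by force
  qed
qed (use \<phi>_mem in blast)

lemma \<phi>_eq_zero_iff: "a \<in> W \<Longrightarrow> \<phi> a = 0 \<longleftrightarrow> a = 0"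
  using fst_f_eq_zero_iff[of a 0] by (simp add: \<phi>_def)

lemma A_additive_bijection: "additive_bijection A"
proof
  show "A (x + y) = A x + A y" for x y
    using f_mult[of 0 0 x y] by (simp add: f_fibre)
  have "inj A"
  proof (rule injI)
    fix x y assume "A x = A y"
    then have "f (0, x) = f (0, y)" by (simp add: f_fibre)
    then show "x = y"
      using f_bij by (auto simp: bij_betw_def dest: inj_onD)
  qed
  moreover have "v \<in> range A" for v
  proof -
    have "(0, v) \<in> f ` (W \<times> UNIV)" using f_bij by (simp add: bij_betw_def)
    then obtain a u where au: "a \<in> W" "f (a, u) = (0, v)" by (auto simp: image_iff)
    then have "a = 0" using fst_f_eq_zero_iff[of a u] by simp
    then show ?thesis using au by (auto simp: f_fibre)
  qed
  ultimately show "bij A" by (auto simp: bij_def)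
qed

sublocale A: additive_bijection A
  by (rule A_additive_bijection)

text \<open>The element \<open>(a, s (1 - a) (1 + a))\<close> is both \<open>(a, 0) (0, s (1 + a))\<close> and
  \<open>(0, s (1 - a)) (a, 0)\<close>. Equating the two images, all terms cancel except
  \<open>2 A (s a) = 2 A s \<cdot> \<phi> a\<close>.\<close>

lemma intertwines_A_\<phi>_odd:
  assumes two: "(2::'a) \<noteq> 0" and a: "a \<in> W"
  shows "intertwines A a (\<phi> a)"
proof -
  have "A (s * a) = A s * \<phi> a" for s
  proof -
    have "(s * (1 + a)) * (1 - a) = (s * (1 - a)) * (1 + a)" by (simp add: algebra_simps)
    then have "f (a, (s * (1 + a)) * (1 - a)) = f (a, (s * (1 - a)) * (1 + a))"
      by (simp only:)
    then have "A (s * (1 + a)) * (1 - \<phi> a) = A (s * (1 - a)) * (1 + \<phi> a)"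
      by (simp only: f_left[OF a] f_right[OF a] prod.inject add.commute add_left_cancel)
    then have "2 * A (s * a) = 2 * (A s * \<phi> a)"
      by (simp add: ring_distribs right_diff_distrib A.add A.diff left_diff_distrib algebra_simps)
    then show ?thesis using two by simp
  qed
  then show ?thesis by (simp add: intertwines_def)
qed

text \<open>In characteristic \<open>2\<close> the square \<open>(a,0) (a,0)\<close> is the identity, whereas multiplying a fibre
  element twice from the left by \<open>(a,0)\<close> scales it by \<open>(1 - a)\<^sup>2 = 1 + a\<^sup>2\<close>. Applying \<open>f\<close>, multiplication
  by \<open>1 + a\<^sup>2\<close> is carried to multiplication by \<open>1 + (\<phi> a)\<^sup>2\<close>.\<close>

lemma intertwines_A_\<phi>_square:
  assumes two: "(2::'a) = 0" and a: "a \<in> W"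
  shows "intertwines A (a * a) (\<phi> a * \<phi> a)"
proof -
  have double: "x + x = 0" for x :: 'a using two by (metis mult_2 mult_zero_left)
  have expand: "x * (1 - y) * (1 - y) = x + x * (y * y)" for x y :: 'a
  proof -
    have "x * (1 - y) * (1 - y) = x + x * (y * y) - (x * y + x * y)" by (simp add: algebra_simps)
    then show ?thesis by (simp add: double)
  qed
  have "A (w * (a * a)) = A w * (\<phi> a * \<phi> a)" for w
  proof -
    let ?Q = "loopQ W"
    (* (a,0) (a,0) = (2a,0) is trivial here, so the left-hand side is just the last factor. *)
    have "((a, 0) \<otimes>\<^bsub>?Q\<^esub> (a, 0)) \<otimes>\<^bsub>?Q\<^esub> (0, w * (1 - a) * (1 - a))
        = (a, 0) \<otimes>\<^bsub>?Q\<^esub> ((a, 0) \<otimes>\<^bsub>?Q\<^esub> (0, w))"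
      by (simp add: double)
    then have "f (((a, 0) \<otimes>\<^bsub>?Q\<^esub> (a, 0)) \<otimes>\<^bsub>?Q\<^esub> (0, w * (1 - a) * (1 - a)))
        = f ((a, 0) \<otimes>\<^bsub>?Q\<^esub> ((a, 0) \<otimes>\<^bsub>?Q\<^esub> (0, w)))" by (rule arg_cong)
    then have "(f (a, 0) \<otimes>\<^bsub>?Q\<^esub> f (a, 0)) \<otimes>\<^bsub>?Q\<^esub> f (0, w * (1 - a) * (1 - a))
        = f (a, 0) \<otimes>\<^bsub>?Q\<^esub> (f (a, 0) \<otimes>\<^bsub>?Q\<^esub> f (0, w))"
      using a by (simp only: f_hom loopQ_closed mem_Sigma_iff UNIV_I simp_thms zero_mem)
    then have "A (w * (1 - a) * (1 - a)) = A w * (1 - \<phi> a) * (1 - \<phi> a)"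
      by (simp add: f_section f_fibre two double algebra_simps)
    then show ?thesis by (simp add: expand A.add)
  qed
  then show ?thesis by (simp add: intertwines_def)
qed

text \<open>The elements whose square is intertwined with something form a subfield, because squaring is
  additive. It contains \<open>W\<close> and hence is everything; as every element is a square, \<open>a\<close> itself is
  intertwined with some \<open>y\<close>. Then \<open>y\<^sup>2 = (\<phi> a)\<^sup>2\<close>, which forces \<open>y = \<phi> a\<close>.\<close>

lemma intertwines_A_\<phi>_even:
  assumes two: "(2::'a) = 0" and perfect: "surj (\<lambda>x::'a. x * x)"
    and k: "prime_subfield k" and gen: "generate_field KK (k \<union> W) = UNIV" and a: "a \<in> W"
  shows "intertwines A a (\<phi> a)"
proof -
  let ?F = "{x. \<exists>y. intertwines A (x * x) y}"
  have double: "x + x = 0" for x :: 'a using two by (metis mult_2 mult_zero_left)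
  have sq_add: "(x + y) * (x + y) = x * x + y * y" for x y :: 'a
    using double[of "x * y"] by (simp add: algebra_simps)
  have sq_inj: "x = y" if "x * x = y * y" for x y :: 'a
  proof -
    have "(x + y) * (x + y) = 0" using that by (simp add: sq_add double)
    then have "x = - y" by (simp add: eq_neg_iff_add_eq_0)
    also have "- y = y" using double[of y] by (simp add: neg_eq_iff_add_eq_0)
    finally show ?thesis .
  qed
  have "subfield ?F KK"
  proof (rule subfield_KK_I)
    show "x * y \<in> ?F" if "x \<in> ?F" "y \<in> ?F" for x y
    proof -
      from that obtain x' y' where "intertwines A (x * x) x'" "intertwines A (y * y) y'" by blast
      then have "intertwines A ((x * y) * (x * y)) (x' * y')"
        using intertwines_mult[of A "x * x" x' "y * y" y'] by (simp add: ac_simps)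
      then show ?thesis by blast
    qed
    show "inverse x \<in> ?F" if "x \<in> ?F" "x \<noteq> 0" for x
      using that A.intertwines_inverse[of "x * x"] by auto
  qed (auto simp: sq_add intro: intertwines_one A.intertwines_add)
  moreover have "k \<subseteq> ?F"
    by (rule prime_subfield_subset[OF k calculation])
  moreover have "W \<subseteq> ?F" using intertwines_A_\<phi>_square[OF two] by blast
  ultimately have "?F = UNIV"
    using field.generate_field_min_subfield1[OF field_from_type_algebra, of "k \<union> W" ?F] gen by auto
  moreover obtain b where "a = b * b" using perfect by (metis surjD)
  ultimately obtain y where y: "intertwines A a y" by blast
  have "y * y = \<phi> a * \<phi> a"
    using intertwines_mult[OF y y] intertwines_A_\<phi>_square[OF two a] intertwines_twist[OF A.bij]
    by metis
  then show ?thesis using y sq_inj by blast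
qed

text \<open>Elements of the form \<open>(a, 0)\<close> have trivial associators, so their images \<open>(\<phi> a, g a)\<close> associate
  too. For the triple \<open>a, e, e\<close> this reads \<open>\<phi> e (g a \<cdot> \<phi> e - g e \<cdot> \<phi> a) = 0\<close>, so \<open>c = g e / \<phi> e\<close> works for
  all \<open>a\<close>.\<close>

lemma g_proportional: obtains c where "\<And>a. a \<in> W \<Longrightarrow> g a = c * \<phi> a"
proof -
  obtain e where e: "e \<in> W" "e \<noteq> 0" by (rule obtain_nonzero)
  then have e': "\<phi> e \<noteq> 0" by (simp add: \<phi>_eq_zero_iff)
  have "g a = g e / \<phi> e * \<phi> a" if a: "a \<in> W" for a
  proof -
    let ?Q = "loopQ W"
    have "f (((a, 0) \<otimes>\<^bsub>?Q\<^esub> (e, 0)) \<otimes>\<^bsub>?Q\<^esub> (e, 0)) = f ((a, 0) \<otimes>\<^bsub>?Q\<^esub> ((e, 0) \<otimes>\<^bsub>?Q\<^esub> (e, 0)))"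
      by (rule arg_cong) (simp add: add.assoc)
    then have "(f (a, 0) \<otimes>\<^bsub>?Q\<^esub> f (e, 0)) \<otimes>\<^bsub>?Q\<^esub> f (e, 0)
        = f (a, 0) \<otimes>\<^bsub>?Q\<^esub> (f (e, 0) \<otimes>\<^bsub>?Q\<^esub> f (e, 0))"
      using a e by (simp only: f_hom loopQ_closed mem_Sigma_iff UNIV_I simp_thms)
    then have "g a * \<phi> e = g e * \<phi> a"
      unfolding f_section loopQ_assoc_iff using e' by simp
    then show ?thesis using e' by (simp add: field_simps)
  qed
  then show thesis by (rule that)
qed

lemma eq_aut_of:
  assumes k: "prime_subfield k" and int: "\<And>a. a \<in> W \<Longrightarrow> intertwines A a (\<phi> a)"
  obtains c where "A \<in> S_stab k W" "f = aut_of A c"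
proof -
  have tw: "twist A a = \<phi> a" if "a \<in> W" for a
    using intertwines_twist[OF A.bij int[OF that]] by simp
  have "twist A ` W = W" using \<phi>_image tw by (simp cong: image_cong)
  then have S: "A \<in> S_stab k W"
    using A.mem_GL_over_prime[OF k] int tw by (simp add: mem_S_stab_iff)
  obtain c where c: "\<And>a. a \<in> W \<Longrightarrow> g a = c * \<phi> a" by (rule g_proportional) blast
  have "f = aut_of A c"
  proof (rule extensionalityI)
    show "f \<in> extensional (W \<times> UNIV)" using autoD(3)[OF f] by simp
    fix x assume "x \<in> W \<times> (UNIV :: 'a set)"
    then obtain a u where x: "x = (a, u)" "a \<in> W" by auto
    obtain v where v: "u = v * (1 - a)"
      using factor_nonzero[OF x(2)] by (metis nonzero_divide_eq_eq)
    have "A u = A v * (1 - \<phi> a)"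
      using intertwinesD[OF int[OF x(2)], of v] by (simp add: v right_diff_distrib A.diff)
    then show "f x = aut_of A c x"
      using f_left[OF x(2), of v] x v by (simp add: tw c)
  qed (simp add: aut_of_def)
  then show thesis using that S by blast
qed

end

section \<open>The isomorphism\<close>

text \<open>The natural map goes from the semidirect product to the automorphism group, while the
  isomorphism is wanted in the other direction. Inverting it only needs closure of the source, so
  the group axioms of neither side have to be checked.\<close>

lemma is_iso_via_inverse:
  assumes bij: "bij_betw h (carrier H) (carrier G)"
    and mult: "\<And>x y. x \<in> carrier H \<Longrightarrow> y \<in> carrier H \<Longrightarrow>
      x \<otimes>\<^bsub>H\<^esub> y \<in> carrier H \<and> h (x \<otimes>\<^bsub>H\<^esub> y) = h x \<otimes>\<^bsub>G\<^esub> h y"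
  shows "G \<cong> H"
proof (rule is_isoI, rule isoI)
  let ?i = "inv_into (carrier H) h"
  show "bij_betw ?i (carrier G) (carrier H)" using bij by (rule bij_betw_inv_into)
  then have mem: "?i x \<in> carrier H" if "x \<in> carrier G" for x using that by (meson bij_betwE)
  show "?i \<in> hom G H"
  proof (rule homI)
    fix x y assume xy: "x \<in> carrier G" "y \<in> carrier G"
    have "h (?i x \<otimes>\<^bsub>H\<^esub> ?i y) = x \<otimes>\<^bsub>G\<^esub> y"
      using mult mem xy bij by (simp add: bij_betw_inv_into_right)
    then show "?i (x \<otimes>\<^bsub>G\<^esub> y) = ?i x \<otimes>\<^bsub>H\<^esub> ?i y"
      using mult mem xy bij by (metis bij_betw_inv_into_left)
  qed (rule mem)
qed

lemma loopQ_space_of_subspace: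
  fixes k W :: "'a::field set"
  assumes k: "subfield k KK" "k \<noteq> UNIV" and W: "k_subspace k W" "k \<inter> W = {0}"
    and gen: "generate_field KK (k \<union> W) = UNIV"
  shows "loopQ_space W"
proof
  interpret subalgebra k W KK by (rule W(1))
  show "0 \<in> W" using one_closed by simp
  show "a + b \<in> W" if "a \<in> W" "b \<in> W" for a b using m_closed[OF that] by simp
  show "- a \<in> W" if "a \<in> W" for a
    using m_inv_closed[OF that] unfolding a_inv_def[symmetric] KK_a_inv .
  have "1 \<in> k" using subringE(3)[OF subfieldE(1)[OF k(1)]] by simp
  then show "1 \<notin> W" using W(2) one_neq_zero by blast
  show "W \<noteq> {0}"
  proof
    assume "W = {0}"
    then have "k \<union> W \<subseteq> k" using W(2) by blast
    then have "generate_field KK (k \<union> W) \<subseteq> k"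
      by (intro field.generate_field_min_subfield1[OF field_from_type_algebra] k(1)) auto
    then show False using gen k(2) by auto
  qed
qed

theorem theorem3p5:
  fixes k W :: "'a :: field set"
  assumes "prime_subfield k" and "k \<noteq> UNIV"
    and "k_subspace k W" and "k \<inter> W = {0}"
    and "generate_field KK (k \<union> W) = UNIV"
    and "CHAR('a) = 2 \<Longrightarrow> perfect_field TYPE('a)"
  shows "Aut (loopQ W) \<cong> semidirect (S_stab k W)"
proof -
  interpret loopQ_space W
    using assms by (intro loopQ_space_of_subspace[of k]) (auto simp: prime_subfield_def)
  have onto: "\<exists>A c. A \<in> S_stab k W \<and> f = aut_of A c" if "f \<in> auto (loopQ W)" for f
  proof -
    interpret f: loopQ_automorphism W f using that by unfold_locales
    have int: "intertwines f.A a (f.\<phi> a)" if a: "a \<in> W" for a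
    proof (cases "(2::'a) = 0")
      case False
      then show ?thesis using a by (rule f.intertwines_A_\<phi>_odd)
    next
      case True
      then have "CHAR('a) dvd 2" by (metis of_nat_eq_0_iff_char_dvd of_nat_numeral)
      then have char: "CHAR('a) = 2"
        by (metis CHAR_not_1 One_nat_def prime_nat_iff two_is_prime_nat)
      then have "surj (\<lambda>x::'a. x * x)"
        using assms(6) by (simp add: perfect_field_def power2_eq_square)
      then show ?thesis using f.intertwines_A_\<phi>_even[OF True] assms(1,5) a by blast
    qed
    show ?thesis using f.eq_aut_of[OF assms(1) int] by blast
  qed
  let ?h = "\<lambda>(A, c). aut_of A c"
  show ?thesis
  proof (rule is_iso_via_inverse[where h = ?h])
    show "bij_betw ?h (carrier (semidirect (S_stab k W))) (carrier (Aut (loopQ W)))"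
    proof (rule bij_betw_imageI)
      show "inj_on ?h (carrier (semidirect (S_stab k W)))"
        by (auto simp: semidirect_def inj_on_def dest: aut_of_inj)
      show "?h ` carrier (semidirect (S_stab k W)) = carrier (Aut (loopQ W))"
        using onto aut_of_mem_auto by (fastforce simp: semidirect_def Aut_def)
    qed
    show "x \<otimes>\<^bsub>semidirect (S_stab k W)\<^esub> y \<in> carrier (semidirect (S_stab k W)) \<and>
        ?h (x \<otimes>\<^bsub>semidirect (S_stab k W)\<^esub> y) = ?h x \<otimes>\<^bsub>Aut (loopQ W)\<^esub> ?h y"
      if "x \<in> carrier (semidirect (S_stab k W))" "y \<in> carrier (semidirect (S_stab k W))" for x y
      using that by (auto simp: semidirect_def Aut_def S_stab_comp aut_of_comp)
  qed
qed

end
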